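(* Let $X,U$ be nonempty sets, $f:X\times U\to X$, $\sigma:X\to\mathbb{R}_{\ge 0}$ and $\rho:U\to\mathbb{R}_{\ge 0}$ arbitrary functions, and consider the system $x_+=f(x,u)$. Let $\mathbb{X}\subseteq X$, $\beta\in\mathcal{KL}$ and $\eta,\gamma\in\mathcal{K}_\infty$ be such that for all $x\in\mathbb{X}$ there exists $u_x\in U^\infty$ with (i) $\sigma(\phi(n;x,u_x))\le\beta(\sigma(x),n)$ for all $n\ge 0$, and (ii) $\sum_{n=0}^{N-1}\eta(\rho(u_x(n)))\le\gamma(\sigma(x))$ for all $N\ge 1$. Let $\theta\in(0,1)$ and $\gamma_1,\gamma_2\in\mathcal{K}_\infty$ satisfy $\beta(s,n)\le\gamma_2(\theta^n\gamma_1(s))$ for all $s\ge 0$, $n\in\mathbb{N}$. Let $q\in\mathcal{K}_\infty$ with $q\le C_q\cdot\gamma_2^{-1}$ for some $C_q>0$, and let $r:\mathbb{R}_{\ge 0}\to\mathbb{R}_{\ge 0}$ with $r\le C_r\cdot\eta$ for some $C_r>0$. Let $s:X\times U\to\mathbb{R}_{\ge 0}$ be any function for which there exist $C_1,C_2,C_3\in\mathbb{R}_{\ge 0}$ and $\alpha\in\mathcal{K}_\infty$ such that for all $(x,u)\in X\times U$ $$s(x,u)\le C_1\gamma_2^{-1}(\sigma(x))+C_2\,\eta(\rho(u))+C_3\,\gamma_2^{-1}(\sigma(x))\,\alpha(\rho(u)).$$ Then the system is uniformly cost controllable on $\mathbb{X}$ with respect to $\ell(x,u)=q(\sigma(x))+r(\rho(u))+s(x,u)$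 and total cost bound $$\bar\alpha=\frac{C_q+C_1}{1-\theta}\gamma_1+(C_r+C_2)\cdot\gamma+\frac{C_3}{1-\theta}\,\gamma_1\cdot(\alpha\circ\eta^{-1}\circ\gamma).$$
   Context: $\mathbb{N}=\{0,1,2,\dots\}$ and $U^\infty=U^{\mathbb{N}}$ is the set of infinite input sequences. Trajectories: $\phi(0;x,u)=x$, $\phi(n+1;x,u)=f(\phi(n;x,u),u(n))$ for $n\ge 0$. Comparison functions: $\mathcal{K}$ is the set of continuous strictly increasing $\alpha:\mathbb{R}_{\ge 0}\to\mathbb{R}_{\ge 0}$ with $\alpha(0)=0$; $\mathcal{K}_\infty$ is the set of $\alpha\in\mathcal{K}$ with $\lim_{s\to\infty}\alpha(s)=\infty$ (these are invertible with inverse in $\mathcal{K}_\infty$); $\mathcal{KL}$ is the set of continuous $\beta:\mathbb{R}_{\ge 0}\times\mathbb{R}_{\ge 0}\to\mathbb{R}_{\ge 0}$ such that $\beta(\cdot,t)\in\mathcal{K}_\infty$ for all $t\ge 0$, and for all $s>0$ the function $\beta(s,\cdot)$ is strictly decreasing with $\lim_{t\to\infty}\beta(s,t)=0$. Operations (including products) and inequalities between such functions are pointwise. For a stage cost $\ell:X\times U\to\mathbb{R}_{\ge 0}$, set $J_\infty(x,u\mid\ell)=\sum_{n=0}^{\infty}\ell(\phi(n;x,u),u(n))\in[0,\infty]$. The system is uniformly cost controllable on $\mathbb{X}$ with respect to $\ell$ and total cost bound $\bar\alpha\in\mathcal{K}_\infty$ if for all $x\in\mathbb{X}$ there exists $u_x\in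 U^\infty$ with $J_\infty(x,u_x\mid\ell)\le\bar\alpha(\sigma(x))$. *)

theory Defs
  imports Complex_Main "HOL-Library.Extended_Nonnegative_Real"
begin

(* Functions on [0,\<infinity>) are represented by functions of type real => real of which only
   the values on {0..} matter. *)

definition class_K :: "(real \<Rightarrow> real) set" where
  "class_K = {\<alpha>. (\<forall>s\<ge>0. 0 \<le> \<alpha> s) \<and> continuous_on {0..} \<alpha> \<and> strict_mono_on {0..} \<alpha> \<and> \<alpha> 0 = 0}"

definition class_K_inf :: "(real \<Rightarrow> real) set" where
  "class_K_inf = {\<alpha> \<in> class_K. filterlim \<alpha> at_top at_top}"

definition class_KL :: "(real \<Rightarrow> real \<Rightarrow> real) set" where
  "class_KL = {\<beta>. (\<forall>s\<ge>0. \<forall>t\<ge>0. 0 \<le> \<beta> s t) \<and>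
     continuous_on ({0..} \<times> {0..}) (\<lambda>(s, t). \<beta> s t) \<and>
     (\<forall>t\<ge>0. (\<lambda>s. \<beta> s t) \<in> class_K_inf) \<and>
     (\<forall>s>0. strict_antimono_on {0..} (\<beta> s) \<and> (\<beta> s \<longlongrightarrow> 0) at_top)}"

(* The inverse as a function on [0,\<infinity>); it is the two-sided inverse for members of class_K_inf. *)
abbreviation K_inverse :: "(real \<Rightarrow> real) \<Rightarrow> real \<Rightarrow> real" where
  "K_inverse \<alpha> \<equiv> inv_into {0..} \<alpha>"

primrec trajectory :: "('x \<Rightarrow> 'u \<Rightarrow> 'x) \<Rightarrow> nat \<Rightarrow> 'x \<Rightarrow> (nat \<Rightarrow> 'u) \<Rightarrow> 'x" where
  "trajectory f 0 x u = x"
| "trajectory f (Suc n) x u = f (trajectory f n x u) (u n)"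

(* Coercing to ennreal truncates negative values at 0; this is harmless because stage costs are
   required to be nonnegative in uniformly_cost_controllable. *)
definition total_cost :: "('x \<Rightarrow> 'u \<Rightarrow> 'x) \<Rightarrow> ('x \<Rightarrow> 'u \<Rightarrow> real) \<Rightarrow> 'x \<Rightarrow> (nat \<Rightarrow> 'u) \<Rightarrow> ennreal" where
  "total_cost f l x u = (\<Sum>n. ennreal (l (trajectory f n x u) (u n)))"

definition uniformly_cost_controllable ::
  "('x \<Rightarrow> 'u \<Rightarrow> 'x) \<Rightarrow> ('x \<Rightarrow> real) \<Rightarrow> 'x set \<Rightarrow> ('x \<Rightarrow> 'u \<Rightarrow> real) \<Rightarrow> (real \<Rightarrow> real) \<Rightarrow> bool" where
  "uniformly_cost_controllable f \<sigma> XX l \<alpha> \<longleftrightarrow>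
     (\<forall>x u. 0 \<le> l x u) \<and> \<alpha> \<in> class_K_inf \<and>
     (\<forall>x\<in>XX. \<exists>u. total_cost f l x u \<le> ennreal (\<alpha> (\<sigma> x)))"

end

theory Submission
  imports Defs
begin

text \<open>
  The stage cost is evaluated along the trajectory \<open>x 0, x 1, \<dots>\<close> that starts in \<open>x\<close> and is generated
  by the control \<open>u\<close> of the hypothesis. Applying the increasing function \<open>\<gamma>\<^sub>2\<^sup>-\<^sup>1\<close> to
  \<open>\<sigma> (x n) \<le> \<beta> (\<sigma> x) n \<le> \<gamma>\<^sub>2 (\<theta> ^ n * \<gamma>\<^sub>1 (\<sigma> x))\<close> shows that every term containing
  \<open>\<gamma>\<^sub>2\<^sup>-\<^sup>1 (\<sigma> (x n))\<close> decays geometrically. The terms \<open>\<eta> (\<rho> (u n))\<close> are summable with total at most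
  \<open>\<gamma> (\<sigma> x)\<close>. In the mixed term, a single summand \<open>\<eta> (\<rho> (u n))\<close> is bounded by the same total,
  so \<open>\<alpha> (\<rho> (u n)) \<le> \<alpha> (\<eta>\<^sup>-\<^sup>1 (\<gamma> (\<sigma> x)))\<close> uniformly in \<open>n\<close>, and the mixed term decays geometrically
  too. Summing the geometric series gives the bound on every partial sum, hence on the total cost.

  That the bound is itself of class \<open>K\<^sub>\<infinity>\<close> follows from the closure of this class under sums, positive
  multiples, products, composition and inversion.
\<close>

section \<open>Closure properties of class \<open>K\<^sub>\<infinity>\<close>\<close>

lemma class_K_infI:
  assumes "continuous_on {0..} a" "strict_mono_on {0..} a" "a 0 = 0" "filterlim a at_top at_top"
  shows "a \<in> class_K_inf"
proof -
  have "0 \<le> a t" if "0 \<le> t" for t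
    using strict_mono_onD[OF assms(2), of 0 t] that assms(3) by (cases "t = 0") auto
  then show ?thesis
    using assms by (simp add: class_K_inf_def class_K_def)
qed

lemma class_K_infD:
  assumes "a \<in> class_K_inf"
  shows "continuous_on {0..} a" "strict_mono_on {0..} a" "a 0 = 0" "filterlim a at_top at_top"
    and "\<And>t. 0 \<le> t \<Longrightarrow> 0 \<le> a t"
  using assms by (auto simp: class_K_inf_def class_K_def)

lemma class_K_inf_less: "a \<in> class_K_inf \<Longrightarrow> 0 \<le> x \<Longrightarrow> x < y \<Longrightarrow> a x < a y"
  using strict_mono_onD[OF class_K_infD(2), of a x y] by auto

lemma class_K_inf_mono: "a \<in> class_K_inf \<Longrightarrow> 0 \<le> x \<Longrightarrow> x \<le> y \<Longrightarrow> a x \<le> a y"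
  using class_K_inf_less[of a x y] by (cases "x = y") auto

lemma class_K_inf_inj_on: "a \<in> class_K_inf \<Longrightarrow> inj_on a {0..}"
  using class_K_infD(2) strict_mono_on_imp_inj_on by blast

lemma class_K_inf_image:
  assumes a: "a \<in> class_K_inf"
  shows "a ` {0..} = {0..}"
proof
  show "a ` {0..} \<subseteq> {0..}"
    using class_K_infD(5)[OF a] by auto
  show "{0..} \<subseteq> a ` {0..}"
  proof
    fix y :: real assume y: "y \<in> {0..}"
    have "eventually (\<lambda>t. y \<le> a t \<and> 0 \<le> t) at_top"
      using class_K_infD(4)[OF a] eventually_ge_at_top[of 0]
      by (auto simp: filterlim_at_top intro: eventually_conj)
    then obtain t where t: "y \<le> a t" "0 \<le> t"
      using eventually_happens'[OF trivial_limit_at_top_linorder] by blast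
    have "continuous_on {0..t} a"
      using class_K_infD(1)[OF a] by (rule continuous_on_subset) auto
    then obtain x where "0 \<le> x" "a x = y"
      using IVT'[of a 0 y t] t y class_K_infD(3)[OF a] by auto
    then show "y \<in> a ` {0..}" by auto
  qed
qed

lemma K_inverse_nonneg: "a \<in> class_K_inf \<Longrightarrow> 0 \<le> y \<Longrightarrow> 0 \<le> K_inverse a y"
  using inv_into_into[of y a "{0..}"] class_K_inf_image[of a] by auto

lemma K_inverse_right: "a \<in> class_K_inf \<Longrightarrow> 0 \<le> y \<Longrightarrow> a (K_inverse a y) = y"
  using f_inv_into_f[of y a "{0..}"] class_K_inf_image[of a] by auto

lemma K_inverse_left: "a \<in> class_K_inf \<Longrightarrow> 0 \<le> x \<Longrightarrow> K_inverse a (a x) = x"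
  using class_K_inf_inj_on by (intro inv_into_f_f) auto

lemma K_inverse_less:
  assumes a: "a \<in> class_K_inf" and "0 \<le> x" "x < y"
  shows "K_inverse a x < K_inverse a y"
proof (rule ccontr)
  assume "\<not> ?thesis"
  then have "a (K_inverse a y) \<le> a (K_inverse a x)"
    using class_K_inf_mono[OF a, of "K_inverse a y" "K_inverse a x"] K_inverse_nonneg[OF a, of y] assms
    by simp
  then show False
    using assms by (simp add: K_inverse_right)
qed

lemma class_K_inf_inverse:
  assumes a: "a \<in> class_K_inf"
  shows "K_inverse a \<in> class_K_inf"
proof (rule class_K_infI)
  show mono: "strict_mono_on {0..} (K_inverse a)"
    using K_inverse_less[OF a] by (intro strict_mono_onI) auto
  show zero: "K_inverse a 0 = 0"
    using K_inverse_left[OF a, of 0] class_K_infD(3)[OF a] by simp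
  \<comment> \<open>Extended by the identity to negative arguments, the inverse is a monotone surjection of the
    whole line, and monotone functions with open image are continuous.\<close>
  define h where "h y = (if 0 \<le> y then K_inverse a y else y)" for y
  have "x \<in> range h" for x
  proof (cases "0 \<le> x")
    case True
    then have "h (a x) = x"
      using class_K_infD(5)[OF a] K_inverse_left[OF a] by (simp add: h_def)
    then show ?thesis by (metis rangeI)
  next
    case False
    then have "h x = x" by (simp add: h_def)
    then show ?thesis by (metis rangeI)
  qed
  then have "range h = UNIV" by auto
  moreover have "h x \<le> h y" if "x \<le> y" for x y
    using that K_inverse_less[OF a, of x y] K_inverse_nonneg[OF a, of y]
    by (cases "x = y") (auto simp: h_def)
  ultimately have "continuous_on UNIV h"
    by (intro continuous_onI_mono) auto
  then have "continuous_on {0..} h"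
    by (rule continuous_on_subset) auto
  then show "continuous_on {0..} (K_inverse a)"
    by (rule continuous_on_cong[THEN iffD1, rotated 2]) (auto simp: h_def)
  show "filterlim (K_inverse a) at_top at_top"
    unfolding filterlim_at_top_ge[where c = 0]
  proof (intro allI impI)
    fix Z :: real assume Z: "0 \<le> Z"
    show "eventually (\<lambda>y. Z \<le> K_inverse a y) at_top"
      using eventually_gt_at_top[of "a Z"]
    proof eventually_elim
      case (elim y)
      then show ?case
        using K_inverse_less[OF a class_K_infD(5)[OF a Z] elim] K_inverse_left[OF a Z] by simp
    qed
  qed
qed

lemma class_K_inf_add:
  assumes a: "a \<in> class_K_inf" and b: "b \<in> class_K_inf"
  shows "(\<lambda>t. a t + b t) \<in> class_K_inf"
proof (rule class_K_infI)
  show "strict_mono_on {0..} (\<lambda>t. a t + b t)"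
    using class_K_inf_less[OF a] class_K_inf_less[OF b]
    by (intro strict_mono_onI) (simp add: add_strict_mono)
  show "continuous_on {0..} (\<lambda>t. a t + b t)"
    by (intro continuous_on_add class_K_infD(1) a b)
  show "filterlim (\<lambda>t. a t + b t) at_top at_top"
    by (intro filterlim_at_top_add_at_top class_K_infD(4) a b)
qed (use class_K_infD(3)[OF a] class_K_infD(3)[OF b] in simp)

lemma class_K_inf_mult:
  assumes a: "a \<in> class_K_inf" and b: "b \<in> class_K_inf"
  shows "(\<lambda>t. a t * b t) \<in> class_K_inf"
proof (rule class_K_infI)
  show "strict_mono_on {0..} (\<lambda>t. a t * b t)"
    using class_K_inf_less[OF a] class_K_inf_less[OF b] class_K_infD(5)[OF a] class_K_infD(5)[OF b]
    by (intro strict_mono_onI) (simp add: mult_strict_mono')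
  show "continuous_on {0..} (\<lambda>t. a t * b t)"
    by (intro continuous_on_mult class_K_infD(1) a b)
  show "filterlim (\<lambda>t. a t * b t) at_top at_top"
    by (intro filterlim_at_top_mult_at_top class_K_infD(4) a b)
qed (use class_K_infD(3)[OF a] class_K_infD(3)[OF b] in simp)

lemma class_K_inf_cmult:
  assumes a: "a \<in> class_K_inf" and "0 < c"
  shows "(\<lambda>t. c * a t) \<in> class_K_inf"
proof (rule class_K_infI)
  show "strict_mono_on {0..} (\<lambda>t. c * a t)"
    using class_K_inf_less[OF a] \<open>0 < c\<close> by (intro strict_mono_onI) simp
  show "filterlim (\<lambda>t. c * a t) at_top at_top"
    using class_K_infD(4)[OF a] \<open>0 < c\<close>
    by (intro filterlim_tendsto_pos_mult_at_top[OF tendsto_const])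
  show "continuous_on {0..} (\<lambda>t. c * a t)"
    by (intro continuous_on_mult_left class_K_infD(1) a)
qed (use class_K_infD(3)[OF a] in simp)

lemma class_K_inf_compose:
  assumes a: "a \<in> class_K_inf" and b: "b \<in> class_K_inf"
  shows "a \<circ> b \<in> class_K_inf"
proof (rule class_K_infI)
  show "strict_mono_on {0..} (a \<circ> b)"
    using class_K_inf_less[OF a] class_K_inf_less[OF b] class_K_infD(5)[OF b]
    by (intro strict_mono_onI) simp
  show "continuous_on {0..} (a \<circ> b)"
    using class_K_infD(1)[OF a] class_K_infD(1)[OF b] class_K_inf_image[OF b]
    by (intro continuous_on_compose) auto
  show "filterlim (a \<circ> b) at_top at_top"
    using filterlim_compose[OF class_K_infD(4)[OF a] class_K_infD(4)[OF b]] by (simp add: o_def)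
qed (use class_K_infD(3)[OF a] class_K_infD(3)[OF b] in simp)

section \<open>The total cost along a controlled trajectory\<close>

lemma total_cost_le:
  assumes "\<And>n. 0 \<le> l (trajectory f n x u) (u n)"
    and "\<And>N. (\<Sum>n<N. l (trajectory f n x u) (u n)) \<le> B"
  shows "total_cost f l x u \<le> ennreal B"
  unfolding total_cost_def
proof (rule suminf_le_const)
  show "(\<Sum>n<N. ennreal (l (trajectory f n x u) (u n))) \<le> ennreal B" for N
    using assms by (simp add: ennreal_leI)
qed simp

lemma geometric_sum_le:
  fixes \<theta> :: real
  assumes "0 \<le> \<theta>" "\<theta> < 1"
  shows "(\<Sum>n<N. \<theta> ^ n) \<le> 1 / (1 - \<theta>)"
  using sum_le_suminf[of "\<lambda>n. \<theta> ^ n" "{..<N}"] assms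
  by (simp add: suminf_geometric)

theorem proposition2:
  fixes f :: "'x \<Rightarrow> 'u \<Rightarrow> 'x"
    and \<sigma> :: "'x \<Rightarrow> real" and \<rho> :: "'u \<Rightarrow> real"
    and XX :: "'x set"
    and \<beta> :: "real \<Rightarrow> real \<Rightarrow> real"
    and \<eta> \<gamma> \<gamma>\<^sub>1 \<gamma>\<^sub>2 q r \<alpha> :: "real \<Rightarrow> real"
    and s :: "'x \<Rightarrow> 'u \<Rightarrow> real"
    and \<theta> C\<^sub>q C\<^sub>r C\<^sub>1 C\<^sub>2 C\<^sub>3 :: real
  assumes "\<And>x. 0 \<le> \<sigma> x" and "\<And>u. 0 \<le> \<rho> u"
    and "\<beta> \<in> class_KL" and "\<eta> \<in> class_K_inf" and "\<gamma> \<in> class_K_inf"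
    and "\<And>x. x \<in> XX \<Longrightarrow> \<exists>u :: nat \<Rightarrow> 'u.
           (\<forall>n. \<sigma> (trajectory f n x u) \<le> \<beta> (\<sigma> x) (real n)) \<and>
           (\<forall>N\<ge>1. (\<Sum>n<N. \<eta> (\<rho> (u n))) \<le> \<gamma> (\<sigma> x))"
    and "0 < \<theta>" and "\<theta> < 1"
    and "\<gamma>\<^sub>1 \<in> class_K_inf" and "\<gamma>\<^sub>2 \<in> class_K_inf"
    and "\<And>t n. 0 \<le> t \<Longrightarrow> \<beta> t (real n) \<le> \<gamma>\<^sub>2 (\<theta> ^ n * \<gamma>\<^sub>1 t)"
    and "q \<in> class_K_inf" and "0 < C\<^sub>q"
    and "\<And>t. 0 \<le> t \<Longrightarrow> q t \<le> C\<^sub>q * K_inverse \<gamma>\<^sub>2 t"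
    and "\<And>t. 0 \<le> t \<Longrightarrow> 0 \<le> r t" and "0 < C\<^sub>r"
    and "\<And>t. 0 \<le> t \<Longrightarrow> r t \<le> C\<^sub>r * \<eta> t"
    and "\<And>x u. 0 \<le> s x u"
    and "0 \<le> C\<^sub>1" and "0 \<le> C\<^sub>2" and "0 \<le> C\<^sub>3" and "\<alpha> \<in> class_K_inf"
    and "\<And>x u. s x u \<le> C\<^sub>1 * K_inverse \<gamma>\<^sub>2 (\<sigma> x) + C\<^sub>2 * \<eta> (\<rho> u)
                 + C\<^sub>3 * K_inverse \<gamma>\<^sub>2 (\<sigma> x) * \<alpha> (\<rho> u)"
  shows "uniformly_cost_controllable f \<sigma> XX
           (\<lambda>x u. q (\<sigma> x) + r (\<rho> u) + s x u)
           (\<lambda>t. (C\<^sub>q + C\<^sub>1) / (1 - \<theta>) * \<gamma>\<^sub>1 t + (C\<^sub>r + C\<^sub>2) * \<gamma> t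
                + C\<^sub>3 / (1 - \<theta>) * (\<gamma>\<^sub>1 t * (\<alpha> \<circ> K_inverse \<eta> \<circ> \<gamma>) t))"
proof -
  note sigma = assms(1) and rho = assms(2) and eta = assms(4) and gam = assms(5)
    and ctrl = assms(6) and theta = assms(7,8) and gam1 = assms(9) and gam2 = assms(10)
    and beta = assms(11) and q = assms(12) and Cq = assms(13) and q_le = assms(14)
    and r = assms(15) and Cr = assms(16) and r_le = assms(17) and s = assms(18)
    and C = assms(19-21) and alpha = assms(22) and s_le = assms(23)
  define A where "A = \<alpha> \<circ> K_inverse \<eta> \<circ> \<gamma>"
  define B where "B = (\<lambda>t. (C\<^sub>q + C\<^sub>1) / (1 - \<theta>) * \<gamma>\<^sub>1 t + (C\<^sub>r + C\<^sub>2) * \<gamma> t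
                + C\<^sub>3 / (1 - \<theta>) * (\<gamma>\<^sub>1 t * A t))"
  define l where "l = (\<lambda>x u. q (\<sigma> x) + r (\<rho> u) + s x u)"
  have A: "A \<in> class_K_inf"
    unfolding A_def by (intro class_K_inf_compose class_K_inf_inverse alpha eta gam)
  have first_two: "(\<lambda>t. (C\<^sub>q + C\<^sub>1) / (1 - \<theta>) * \<gamma>\<^sub>1 t + (C\<^sub>r + C\<^sub>2) * \<gamma> t) \<in> class_K_inf"
    using Cq Cr C theta by (intro class_K_inf_add class_K_inf_cmult gam1 gam) auto
  have B: "B \<in> class_K_inf"
  proof (cases "C\<^sub>3 = 0")
    case True
    then show ?thesis using first_two by (simp add: B_def)
  next
    case False
    then have "0 < C\<^sub>3 / (1 - \<theta>)" using C theta by simp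
    then show ?thesis
      unfolding B_def by (intro class_K_inf_add[OF first_two] class_K_inf_cmult class_K_inf_mult gam1 A)
  qed
  have l_nonneg: "0 \<le> l x u" for x u
    unfolding l_def using class_K_infD(5)[OF q] sigma r rho s by simp
  have "\<exists>u. total_cost f l x u \<le> ennreal (B (\<sigma> x))" if x: "x \<in> XX" for x
  proof -
    define g where "g = \<gamma>\<^sub>1 (\<sigma> x)"
    have g: "0 \<le> g" unfolding g_def using class_K_infD(5)[OF gam1] sigma by simp
    have Ax: "0 \<le> A (\<sigma> x)" using class_K_infD(5)[OF A] sigma by simp
    obtain u where u1: "\<And>n. \<sigma> (trajectory f n x u) \<le> \<beta> (\<sigma> x) (real n)"
      and u2: "\<And>N. N \<ge> 1 \<Longrightarrow> (\<Sum>n<N. \<eta> (\<rho> (u n))) \<le> \<gamma> (\<sigma> x)"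
      using ctrl[OF x] by blast
    define w where "w n = \<eta> (\<rho> (u n))" for n
    have w: "0 \<le> w n" for n
      unfolding w_def using class_K_infD(5)[OF eta] rho by simp
    have w_sum: "(\<Sum>n<N. w n) \<le> \<gamma> (\<sigma> x)" for N
      using u2[of N] class_K_infD(5)[OF gam] sigma by (cases N) (auto simp: w_def)
    have state_le: "K_inverse \<gamma>\<^sub>2 (\<sigma> (trajectory f n x u)) \<le> \<theta> ^ n * g" for n
    proof -
      have "\<sigma> (trajectory f n x u) \<le> \<gamma>\<^sub>2 (\<theta> ^ n * g)"
        using u1[of n] beta[OF sigma, of x n] by (simp add: g_def)
      then have "K_inverse \<gamma>\<^sub>2 (\<sigma> (trajectory f n x u)) \<le> K_inverse \<gamma>\<^sub>2 (\<gamma>\<^sub>2 (\<theta> ^ n * g))"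
        by (intro class_K_inf_mono[OF class_K_inf_inverse[OF gam2]] sigma)
      then show ?thesis
        using g theta by (simp add: K_inverse_left[OF gam2])
    qed
    have input_le: "\<alpha> (\<rho> (u n)) \<le> A (\<sigma> x)" for n
    proof -
      have "w n \<le> (\<Sum>k<Suc n. w k)"
        using w by (intro member_le_sum) auto
      then have "w n \<le> \<gamma> (\<sigma> x)" using w_sum[of "Suc n"] by linarith
      then have "K_inverse \<eta> (w n) \<le> K_inverse \<eta> (\<gamma> (\<sigma> x))"
        by (intro class_K_inf_mono[OF class_K_inf_inverse[OF eta]] w)
      then have "\<rho> (u n) \<le> K_inverse \<eta> (\<gamma> (\<sigma> x))"
        using K_inverse_left[OF eta rho] by (simp add: w_def)
      then show ?thesis
        unfolding A_def using class_K_inf_mono[OF alpha rho] by simp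
    qed
    have l_le: "l (trajectory f n x u) (u n)
        \<le> (C\<^sub>q + C\<^sub>1 + C\<^sub>3 * A (\<sigma> x)) * g * \<theta> ^ n + (C\<^sub>r + C\<^sub>2) * w n" for n
    proof -
      define z where "z = K_inverse \<gamma>\<^sub>2 (\<sigma> (trajectory f n x u))"
      have z: "0 \<le> z" "z \<le> \<theta> ^ n * g"
        using K_inverse_nonneg[OF gam2 sigma] state_le by (auto simp: z_def)
      have "l (trajectory f n x u) (u n)
          \<le> C\<^sub>q * z + C\<^sub>r * w n + (C\<^sub>1 * z + C\<^sub>2 * w n + C\<^sub>3 * (z * \<alpha> (\<rho> (u n))))"
        unfolding l_def z_def w_def mult.assoc[symmetric]
        by (intro add_mono q_le r_le s_le sigma rho)
      also have "\<dots> \<le> C\<^sub>q * (\<theta> ^ n * g) + C\<^sub>r * w n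
          + (C\<^sub>1 * (\<theta> ^ n * g) + C\<^sub>2 * w n + C\<^sub>3 * ((\<theta> ^ n * g) * A (\<sigma> x)))"
        using z C Cq Cr input_le[of n] class_K_infD(5)[OF alpha rho]
        by (intro add_mono mult_left_mono mult_mono) auto
      finally show ?thesis by (simp add: algebra_simps)
    qed
    have "(\<Sum>n<N. l (trajectory f n x u) (u n)) \<le> B (\<sigma> x)" for N
    proof -
      have "(\<Sum>n<N. l (trajectory f n x u) (u n))
          \<le> (\<Sum>n<N. (C\<^sub>q + C\<^sub>1 + C\<^sub>3 * A (\<sigma> x)) * g * \<theta> ^ n + (C\<^sub>r + C\<^sub>2) * w n)"
        by (intro sum_mono l_le)
      also have "\<dots> = (C\<^sub>q + C\<^sub>1 + C\<^sub>3 * A (\<sigma> x)) * g * (\<Sum>n<N. \<theta> ^ n) + (C\<^sub>r + C\<^sub>2) * (\<Sum>n<N. w n)"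
        by (simp add: sum.distrib sum_distrib_left)
      also have "\<dots> \<le> (C\<^sub>q + C\<^sub>1 + C\<^sub>3 * A (\<sigma> x)) * g * (1 / (1 - \<theta>)) + (C\<^sub>r + C\<^sub>2) * \<gamma> (\<sigma> x)"
        using C Cq Cr Ax g theta w_sum
        by (intro add_mono mult_left_mono geometric_sum_le mult_nonneg_nonneg add_nonneg_nonneg) auto
      also have "\<dots> = B (\<sigma> x)"
        by (simp add: B_def g_def add_divide_distrib algebra_simps)
      finally show ?thesis .
    qed
    then have "total_cost f l x u \<le> ennreal (B (\<sigma> x))"
      using l_nonneg by (intro total_cost_le)
    then show ?thesis by blast
  qed
  then have "uniformly_cost_controllable f \<sigma> XX l B"
    unfolding uniformly_cost_controllable_def using l_nonneg B by blast
  then show ?thesis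
    unfolding l_def B_def A_def .
qed

end
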